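(* Let $\mathcal{H}$ be a complex Hilbert space. If $E\subseteq\mathcal{H}$ is a subset for which the functions $h_v([x]) := |\langle v,x\rangle|$, $v\in E$, separate the points of $\overline{\mathbb{P}}(\mathcal{H})$, then the topology on $\mathbb{P}(\mathcal{H})$ is the initial topology with respect to the family $(h_v)_{v\in E}$. This is in particular the case for $E=\mathcal{H}$.
   Context: $\mathbb{S}(\mathcal{H})=\{v\in\mathcal{H}:\|v\|=1\}$ carries the norm topology, $\mathbb{T}=\{z\in\mathbb{C}:|z|=1\}$, and $\mathbb{P}(\mathcal{H})=\mathbb{S}(\mathcal{H})/\mathbb{T}$ (the space of one-dimensional subspaces $[v]$) carries the quotient topology. $\overline{\mathbb{S}}(\mathcal{H})=\{v\in\mathcal{H}:\|v\|\le 1\}$ is the closed unit ball with the weak topology, and $\overline{\mathbb{P}}(\mathcal{H}):=\overline{\mathbb{S}}(\mathcal{H})/\mathbb{T}$ is the quotient space, with elements $[x]=\mathbb{T}x$; $\mathbb{P}(\mathcal{H})$ is viewed as a subset of $\overline{\mathbb{P}}(\mathcal{H})$. The functions $h_v$ are defined on $\overline{\mathbb{P}}(\mathcal{H})$, and on $\mathbb{P}(\mathcal{H})$ by using unit representatives $x$. *)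

theory Defs
  imports "HOL-Analysis.Analysis"
begin

text \<open>Complex Hilbert spaces. The inner product is antilinear in its first and linear in its
  second argument. The unit law for \<open>scaleC\<close> and positive definiteness of \<open>cinner\<close> are not
  listed: they follow from \<open>scaleR_scaleC\<close> and \<open>cinner_self\<close>.\<close>

class complex_hilbert_space = banach +
  fixes scaleC :: "complex \<Rightarrow> 'a \<Rightarrow> 'a" (infixr \<open>*\<^sub>C\<close> 75)
    and cinner :: "'a \<Rightarrow> 'a \<Rightarrow> complex"
  assumes scaleR_scaleC: "scaleR r x = complex_of_real r *\<^sub>C x"
    and scaleC_add_right: "a *\<^sub>C (x + y) = a *\<^sub>C x + a *\<^sub>C y"
    and scaleC_add_left: "(a + b) *\<^sub>C x = a *\<^sub>C x + b *\<^sub>C x"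
    and scaleC_scaleC: "a *\<^sub>C (b *\<^sub>C x) = (a * b) *\<^sub>C x"
    and cinner_commute: "cinner x y = cnj (cinner y x)"
    and cinner_add_right: "cinner x (y + z) = cinner x y + cinner x z"
    and cinner_scaleC_right: "cinner x (a *\<^sub>C y) = a * cinner x y"
    and cinner_self: "cinner x x = complex_of_real ((norm x)\<^sup>2)"

lemma scaleC_one: "1 *\<^sub>C (x :: 'h::complex_hilbert_space) = x"
  by (metis of_real_1 scaleR_one scaleR_scaleC)

instantiation complex :: complex_hilbert_space
begin

definition scaleC_complex :: "complex \<Rightarrow> complex \<Rightarrow> complex"
  where "scaleC_complex a x = a * x"

definition cinner_complex :: "complex \<Rightarrow> complex \<Rightarrow> complex"
  where "cinner_complex x y = cnj x * y"

instance
proof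
  fix x :: complex
  show "cinner x x = complex_of_real ((norm x)\<^sup>2)"
    unfolding cinner_complex_def by (metis complex_norm_square mult.commute)
qed (auto simp: scaleC_complex_def cinner_complex_def scaleR_conv_of_real algebra_simps)

end


definition quotient_topology :: "'a topology \<Rightarrow> ('a \<Rightarrow> 'b) \<Rightarrow> 'b topology"
  where "quotient_topology X q =
    topology (\<lambda>U. U \<subseteq> q ` topspace X \<and> openin X {x \<in> topspace X. q x \<in> U})"

lemma openin_quotient_topology:
  "openin (quotient_topology X q) U \<longleftrightarrow>
     U \<subseteq> q ` topspace X \<and> openin X {x \<in> topspace X. q x \<in> U}"
proof -
  have "istopology (\<lambda>U. U \<subseteq> q ` topspace X \<and> openin X {x \<in> topspace X. q x \<in> U})"
    unfolding istopology_def
  proof (intro conjI allI impI, goal_cases)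
    case (1 S T)
    then show ?case by blast
  next
    case (2 S T)
    have "{x \<in> topspace X. q x \<in> S \<inter> T} =
      {x \<in> topspace X. q x \<in> S} \<inter> {x \<in> topspace X. q x \<in> T}" by auto
    with 2 show ?case by auto
  next
    case (3 K)
    then show ?case by blast
  next
    case (4 K)
    have "{x \<in> topspace X. q x \<in> \<Union>K} = (\<Union>S\<in>K. {x \<in> topspace X. q x \<in> S})" by auto
    with 4 show ?case by auto
  qed
  then show ?thesis
    by (simp add: quotient_topology_def topology_inverse')
qed

lemma topspace_quotient_topology: "topspace (quotient_topology X q) = q ` topspace X"
proof (rule antisym)
  show "topspace (quotient_topology X q) \<subseteq> q ` topspace X"
    using openin_quotient_topology[of X q "topspace (quotient_topology X q)"] by simp
  have "{x \<in> topspace X. q x \<in> q ` topspace X} = topspace X" by auto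
  then show "q ` topspace X \<subseteq> topspace (quotient_topology X q)"
    by (intro openin_subset) (simp add: openin_quotient_topology)
qed

lemma quotient_map_quotient_topology: "quotient_map X (quotient_topology X q) q"
  by (auto simp: quotient_map_def topspace_quotient_topology openin_quotient_topology)


text \<open>The carrier \<open>S\<close> belongs to the subbase so that the topology lives on all of \<open>S\<close> even when
  the index set is empty.\<close>

definition initial_topology ::
    "'a set \<Rightarrow> 'i set \<Rightarrow> ('i \<Rightarrow> 'a \<Rightarrow> 'b::topological_space) \<Rightarrow> 'a topology"
  where "initial_topology S I f =
    topology_generated_by (insert S {f i -` U \<inter> S | i U. i \<in> I \<and> open U})"

lemma topspace_initial_topology: "topspace (initial_topology S I f) = S"
  by (auto simp: initial_topology_def)

lemma continuous_map_initial_topology: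
  "i \<in> I \<Longrightarrow> continuous_map (initial_topology S I f) euclidean (f i)"
  unfolding continuous_map_alt topspace_initial_topology
  by (auto simp: initial_topology_def intro!: topology_generated_by_Basis)

lemma initial_topology_coarsest:
  assumes "topspace T = S" and "\<And>i. i \<in> I \<Longrightarrow> continuous_map T euclidean (f i)"
    and "openin (initial_topology S I f) U"
  shows "openin T U"
proof -
  have "continuous_map T (initial_topology S I f) id"
    unfolding initial_topology_def
  proof (rule continuous_on_generated_topo)
    fix V assume "V \<in> insert S {f i -` U \<inter> S | i U. i \<in> I \<and> open U}"
    then show "openin T (id -` V \<inter> topspace T)"
      using assms(1,2) by (auto simp: continuous_map_alt)
  qed (use assms(1) in auto)
  from openin_continuous_map_preimage[OF this assms(3)]
  have "openin T {x \<in> topspace T. x \<in> U}" by simp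
  moreover have "U \<subseteq> S"
    using openin_subset[OF assms(3)] by (simp add: topspace_initial_topology)
  ultimately show ?thesis
    using assms(1) by (simp add: Collect_conj_eq Int_absorb1)
qed


text \<open>Points of the projective spaces are the orbits \<open>[x]\<close> of the circle group as sets, so that
  \<open>proj_space\<close> is literally a subset of \<open>proj_closure\<close>.\<close>

definition phase_orbit :: "'h::complex_hilbert_space \<Rightarrow> 'h set"
  where "phase_orbit x = {z *\<^sub>C x | z. cmod z = 1}"

definition proj_space :: "'h::complex_hilbert_space set set"
  where "proj_space = phase_orbit ` sphere 0 1"

definition proj_closure :: "'h::complex_hilbert_space set set"
  where "proj_closure = phase_orbit ` cball 0 1"

definition proj_topology :: "'h::complex_hilbert_space set topology"
  where "proj_topology = quotient_topology (top_of_set (sphere 0 1)) phase_orbit"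

lemma proj_space_subset_closure: "proj_space \<subseteq> proj_closure"
  by (auto simp: proj_space_def proj_closure_def)

lemma topspace_proj_topology: "topspace proj_topology = proj_space"
  by (simp add: proj_topology_def proj_space_def topspace_quotient_topology)

text \<open>\<open>proj_fun v [x] = \<bar>\<langle>v, x\<rangle>\<bar>\<close>, the common value on all representatives of the class.\<close>

definition proj_fun :: "'h::complex_hilbert_space \<Rightarrow> 'h set \<Rightarrow> real"
  where "proj_fun v p = the_elem ((\<lambda>x. cmod (cinner v x)) ` p)"

lemma proj_fun_phase_orbit: "proj_fun v (phase_orbit x) = cmod (cinner v x)"
proof -
  have "(\<lambda>y. cmod (cinner v y)) ` phase_orbit x = {cmod (cinner v x)}"
    by (auto simp: phase_orbit_def cinner_scaleC_right norm_mult image_iff intro!: exI[of _ 1])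
       (metis norm_one scaleC_one)
  then show ?thesis
    by (simp add: proj_fun_def)
qed

definition separates_points :: "'a set \<Rightarrow> 'i set \<Rightarrow> ('i \<Rightarrow> 'a \<Rightarrow> 'b) \<Rightarrow> bool"
  where "separates_points S I f \<longleftrightarrow> (\<forall>x\<in>S. \<forall>y\<in>S. x \<noteq> y \<longrightarrow> (\<exists>i\<in>I. f i x \<noteq> f i y))"

end

theory Submission
  imports Defs
begin

text \<open>The closed unit ball is weakly compact: identify its points \<open>y\<close> with the real functionals
  \<open>v \<mapsto> Re \<langle>v, y\<rangle>\<close> and use Tychonoff and Riesz. Fix a unit vector \<open>x\<close> and \<open>c < 1\<close>. On the weakly
  compact set of all \<open>y\<close> in the ball with \<open>\<bar>\<langle>x, y\<rangle>\<bar> \<le> c\<close> each point is told apart from \<open>x\<close> by some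
  \<open>h\<^sub>v\<close>, hence finitely many \<open>v \<in> E\<close> and a margin suffice, so they cut out a neighbourhood of
  \<open>[x]\<close> in the initial topology on which \<open>\<bar>\<langle>x, y\<rangle>\<bar> > c\<close>. For unit vectors
  \<open>dist(x, \<T>y)\<^sup>2 \<le> 2 - 2 \<bar>\<langle>x, y\<rangle>\<bar>\<close>, so this neighbourhood is small in the quotient topology.\<close>

section \<open>Geometry of complex Hilbert spaces\<close>

lemma cinner_add_left: "cinner (x + y) z = cinner x z + cinner y z"
  for x y z :: "'h::complex_hilbert_space"
  by (metis cinner_add_right cinner_commute complex_cnj_add)

lemma cinner_scaleC_left: "cinner (a *\<^sub>C x) y = cnj a * cinner x y"
  for x y :: "'h::complex_hilbert_space"
  by (metis cinner_commute cinner_scaleC_right complex_cnj_mult)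

lemma cinner_scaleR_right: "cinner x (r *\<^sub>R y) = r * cinner x y"
  for x y :: "'h::complex_hilbert_space"
  by (simp add: scaleR_scaleC cinner_scaleC_right)

lemma cinner_scaleR_left: "cinner (r *\<^sub>R x) y = r * cinner x y"
  for x y :: "'h::complex_hilbert_space"
  by (simp add: scaleR_scaleC cinner_scaleC_left)

lemma cmod_cinner_commute: "cmod (cinner x y) = cmod (cinner y x)"
  for x y :: "'h::complex_hilbert_space"
  by (metis cinner_commute complex_mod_cnj)

text \<open>Both sides are nonnegative, and \<open>cinner_self\<close> turns the equality of their
  squares into sesquilinearity.\<close>

lemma norm_scaleC: "norm (a *\<^sub>C x) = cmod a * norm x"
  for x :: "'h::complex_hilbert_space"
proof -
  have "complex_of_real ((norm (a *\<^sub>C x))\<^sup>2) = complex_of_real ((cmod a * norm x)\<^sup>2)"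
    unfolding cinner_self[of "a *\<^sub>C x", symmetric] cinner_scaleC_left cinner_scaleC_right
      cinner_self[of x] power_mult_distrib of_real_mult complex_norm_square[of a]
    by (simp only: mult_ac)
  then have "(norm (a *\<^sub>C x))\<^sup>2 = (cmod a * norm x)\<^sup>2"
    by (simp only: of_real_eq_iff)
  then show ?thesis
    by (rule power2_eq_imp_eq) auto
qed

lemma norm_add_power2: "(norm (x + y))\<^sup>2 = (norm x)\<^sup>2 + (norm y)\<^sup>2 + 2 * Re (cinner x y)"
  for x y :: "'h::complex_hilbert_space"
proof -
  have "complex_of_real ((norm (x + y))\<^sup>2) =
      complex_of_real ((norm x)\<^sup>2) + complex_of_real ((norm y)\<^sup>2) + (cinner x y + cinner y x)"
    by (simp only: cinner_self[symmetric] cinner_add_left cinner_add_right) simp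
  then have "Re (complex_of_real ((norm (x + y))\<^sup>2)) =
      (norm x)\<^sup>2 + (norm y)\<^sup>2 + (Re (cinner x y) + Re (cinner y x))"
    by (simp del: of_real_power)
  moreover have "Re (cinner y x) = Re (cinner x y)"
    by (metis cinner_commute complex_cnj(1) complex.sel(1) complex_surj)
  ultimately show ?thesis by simp
qed

text \<open>Rotating \<open>y\<close> so that its inner product with \<open>x\<close> becomes real
  and nonnegative makes the cross term as large as possible. This yields Cauchy-Schwarz, the
  estimate for small neighbourhoods and the separation of points.\<close>

lemma ex_phase_norm_diff_power2:
  fixes x y :: "'h::complex_hilbert_space"
  obtains z where "cmod z = 1"
    "(norm (x - z *\<^sub>C y))\<^sup>2 = (norm x)\<^sup>2 + (norm y)\<^sup>2 - 2 * cmod (cinner x y)"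
proof -
  obtain w where w: "cmod w = 1" "w * cinner x y = cmod (cinner x y)"
  proof (cases "cinner x y = 0")
    case True
    then show ?thesis by (intro that[of 1]) auto
  next
    case False
    then show ?thesis
      by (intro that[of "cnj (cinner x y) / cmod (cinner x y)"])
         (auto simp: norm_divide divide_simps complex_norm_square[symmetric] power2_eq_square
           mult.commute simp flip: of_real_mult)
  qed
  \<comment> \<open>Additivity in the scalar identifies \<open>(- w) *\<^sub>C y\<close> with the
    additive inverse of \<open>w *\<^sub>C y\<close>.\<close>
  have "w *\<^sub>C y + (- w) *\<^sub>C y = 0"
    by (metis add.right_inverse scaleC_add_left of_real_0 scaleR_scaleC scaleR_zero_left)
  then have diff: "x - w *\<^sub>C y = x + (- w) *\<^sub>C y"
    by (simp add: diff_conv_add_uminus minus_unique)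
  show ?thesis
  proof (rule that[OF w(1)])
    show "(norm (x - w *\<^sub>C y))\<^sup>2 = (norm x)\<^sup>2 + (norm y)\<^sup>2 - 2 * cmod (cinner x y)"
      unfolding diff norm_add_power2 by (simp add: norm_scaleC w cinner_scaleC_right)
  qed
qed

text \<open>Cauchy-Schwarz: a square in \<open>ex_phase_norm_diff_power2\<close> is nonnegative,
  which gives \<open>half\<close>; normalising both vectors sharpens it to the product of
  norms.\<close>

lemma cmod_cinner_le: "cmod (cinner x y) \<le> norm x * norm y"
  for x y :: "'h::complex_hilbert_space"
proof -
  have half: "2 * cmod (cinner a b) \<le> (norm a)\<^sup>2 + (norm b)\<^sup>2" for a b :: 'h
    by (rule ex_phase_norm_diff_power2[of a b]) (smt (verit) zero_le_power2)
  show ?thesis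
  proof (cases "x = 0 \<or> y = 0")
    case True
    then show ?thesis
      using cinner_scaleR_right[of x 0 y] cinner_scaleR_left[of 0 x y] by auto
  next
    case False
    then show ?thesis
      using half[of "x /\<^sub>R norm x" "y /\<^sub>R norm y"]
      by (simp add: cinner_scaleR_left cinner_scaleR_right norm_mult norm_divide field_simps)
  qed
qed

lemma bounded_linear_cinner: "bounded_linear (cinner v)"
  for v :: "'h::complex_hilbert_space"
  by (rule bounded_linear_intro[where K = "norm v"])
     (auto simp: cinner_add_right cinner_scaleR_right scaleR_conv_of_real
       intro: order_trans[OF cmod_cinner_le])

lemma phase_orbit_scaleC:
  fixes x :: "'h::complex_hilbert_space"
  assumes "cmod z = 1"
  shows "phase_orbit (z *\<^sub>C x) = phase_orbit x"
proof -
  have "\<exists>w'. w *\<^sub>C x = w' *\<^sub>C z *\<^sub>C x \<and> cmod w' = 1" if "cmod w = 1" for w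
    using assms that
    by (intro exI[of _ "w / z"]) (auto simp: scaleC_scaleC norm_divide)
  then show ?thesis
    using assms by (auto simp: phase_orbit_def scaleC_scaleC norm_mult)
qed

section \<open>Weak compactness of the unit ball\<close>

text \<open>The representing vector minimises \<open>J\<close>; the parallelogram identity makes minimising
  sequences Cauchy.\<close>

lemma riesz_unit_ball:
  fixes g :: "'h::complex_hilbert_space \<Rightarrow> real"
  assumes lin: "linear g" and bound: "\<And>v. \<bar>g v\<bar> \<le> norm v"
  obtains y where "norm y \<le> 1" "\<And>v. Re (cinner v y) = g v"
proof -
  interpret linear g by (fact lin)
  have blin: "bounded_linear g"
    by (rule bounded_linear_intro[where K = 1]) (use bound in \<open>auto simp: add scale\<close>)
  define J where "J v = (norm v)\<^sup>2 - 2 * g v" for v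
  \<comment> \<open>By \<open>bound\<close>, \<open>J v + 1\<close> is at least
    \<open>(norm v - 1)\<^sup>2\<close>.\<close>
  have J_ge: "J v \<ge> -1" for v
    using bound[of v] zero_le_power2[of "norm v - 1"]
    unfolding J_def power2_diff by (simp add: abs_le_iff)
  define m where "m = Inf (range J)"
  have m_le: "m \<le> J v" for v
    unfolding m_def by (rule cInf_lower) (auto intro!: bdd_belowI[of _ "-1"] J_ge)
  have "\<exists>v. J v < m + 1 / Suc n" for n
    using cInf_lessD[of "range J" "m + 1 / Suc n"] unfolding m_def by auto
  then obtain u where u: "\<And>n. J (u n) < m + 1 / Suc n"
    by metis
  have parallelogram: "(norm (a - b))\<^sup>2 \<le> 2 * (J a - m) + 2 * (J b - m)" for a b
  proof -
    have "a - b = a + (-1) *\<^sub>R b" by simp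
    then have 1: "(norm (a - b))\<^sup>2 = (norm a)\<^sup>2 + (norm b)\<^sup>2 - 2 * Re (cinner a b)"
      by (simp only: norm_add_power2 cinner_scaleR_right) simp
    \<comment> \<open>The midpoint also has \<open>J\<close> at least \<open>m\<close>, which bounds
      the norm of \<open>a + b\<close> from below and hence that of \<open>a - b\<close> from
      above.\<close>
    have "4 * J ((1/2) *\<^sub>R (a + b)) = (norm (a + b))\<^sup>2 - 4 * (g a + g b)"
      unfolding J_def norm_scaleR power_mult_distrib scale add by (simp add: power2_eq_square field_simps)
    then have "4 * m \<le> (norm (a + b))\<^sup>2 - 4 * (g a + g b)"
      using m_le[of "(1/2) *\<^sub>R (a + b)"] by linarith
    with 1 show ?thesis
      using norm_add_power2[of a b] unfolding J_def by (simp add: algebra_simps)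
  qed
  have "Cauchy u"
  proof (rule metric_CauchyI)
    fix e :: real assume e: "e > 0"
    \<comment> \<open>Division by 4: two excesses over \<open>m\<close>, each below
      \<open>1 / Suc N\<close> and each counted twice in \<open>parallelogram\<close>.\<close>
    then obtain N where N: "1 / Suc N < e\<^sup>2 / 4"
      using nat_approx_posE[of "e\<^sup>2 / 4"] by auto
    have "dist (u i) (u j) < e" if "i \<ge> N" "j \<ge> N" for i j
    proof -
      have "1 / Suc i \<le> 1 / Suc N" "1 / Suc j \<le> 1 / Suc N"
        using that by (auto simp: divide_simps)
      with N have "2 * (J (u i) - m) + 2 * (J (u j) - m) < e\<^sup>2"
        using u[of i] u[of j] by argo
      with parallelogram have "(norm (u i - u j))\<^sup>2 < e\<^sup>2"
        by (rule le_less_trans)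
      then show ?thesis
        using e by (simp add: dist_norm power_less_imp_less_base)
    qed
    then show "\<exists>N. \<forall>i\<ge>N. \<forall>j\<ge>N. dist (u i) (u j) < e" by blast
  qed
  then obtain y where y: "u \<longlonglongrightarrow> y"
    using Cauchy_convergent convergent_def by blast
  have "(\<lambda>n. J (u n)) \<longlonglongrightarrow> J y"
    unfolding J_def by (intro tendsto_intros bounded_linear.tendsto[OF blin] y)
  moreover have "(\<lambda>n. m + 1 / Suc n) \<longlonglongrightarrow> m + 0"
    by (intro tendsto_intros LIMSEQ_Suc[OF lim_1_over_n])
  ultimately have "J y \<le> m + 0"
    by (rule LIMSEQ_le) (use u in \<open>auto intro!: exI[of _ 0] less_imp_le\<close>)
  then have min: "J y \<le> J v" for v
    using m_le[of v] by simp
  have eq: "Re (cinner y v) = g v" for v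
  proof (rule ccontr)
    \<comment> \<open>\<open>2 * d\<close> is the derivative of \<open>J\<close> at the minimiser
      \<open>y\<close> in direction \<open>v\<close>, so it has to vanish.\<close>
    define d where "d = Re (cinner y v) - g v"
    assume "Re (cinner y v) \<noteq> g v"
    then have "d \<noteq> 0" by (simp add: d_def)
    \<comment> \<open>The summand 1 keeps \<open>s\<close> positive when \<open>v = 0\<close>;
      \<open>t = - d / s\<close> then minimises \<open>2 * t * d + t\<^sup>2 * s\<close>.\<close>
    define s where "s = (norm v)\<^sup>2 + 1"
    have s: "s > 0" unfolding s_def by (simp add: add_nonneg_pos)
    define t where "t = - d / s"
    have "J (y + t *\<^sub>R v) = J y + 2 * t * d + t\<^sup>2 * (norm v)\<^sup>2"
      unfolding J_def d_def norm_add_power2 add scale cinner_scaleR_right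
      by (simp add: power_mult_distrib algebra_simps)
    then have "0 \<le> 2 * t * d + t\<^sup>2 * (s - 1)"
      using min[of "y + t *\<^sub>R v"] by (simp add: s_def)
    also have "\<dots> \<le> 2 * t * d + t\<^sup>2 * s" by (simp add: algebra_simps)
    also have "\<dots> = - d\<^sup>2 / s"
      using s unfolding t_def by (simp add: field_simps power2_eq_square)
    also have "\<dots> < 0" using s \<open>d \<noteq> 0\<close> by simp
    finally show False by simp
  qed
  have "(norm y)\<^sup>2 = g y"
    using eq[of y] by (simp add: cinner_self flip: of_real_power)
  then have "norm y * norm y \<le> norm y * 1"
    using bound[of y] by (simp add: power2_eq_square abs_le_iff)
  then have "norm y \<le> 1"
    by (cases "y = 0") (auto simp: mult_le_cancel_left)
  moreover have "Re (cinner v y) = g v" for v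
    using eq[of v] by (metis cinner_commute complex_cnj(1) complex.sel(1) complex_surj)
  ultimately show ?thesis by (rule that)
qed

text \<open>The closed unit ball in its weak topology: by \<open>riesz_unit_ball\<close> and
  \<open>ball_functional_cinner\<close> the members are exactly the real parts of the pairings with
  vectors of norm at most 1, and the function type carries pointwise convergence.\<close>

definition ball_functionals :: "('h::complex_hilbert_space \<Rightarrow> real) set"
  where "ball_functionals = {g. linear g \<and> (\<forall>v. \<bar>g v\<bar> \<le> norm v)}"

lemma continuous_on_eval: "continuous_on A (\<lambda>g :: 'a \<Rightarrow> 'b::topological_space. g v)"
  by (rule continuous_on_subset[OF continuous_on_product_coordinates]) simp

text \<open>Tychonoff makes the product \<open>?B\<close> of compact intervals compact; linearity is
  a family of equations between finitely many evaluations each, so it cuts out a closed set.\<close>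

lemma compact_ball_functionals: "compact (ball_functionals :: ('h::complex_hilbert_space \<Rightarrow> real) set)"
proof -
  let ?B = "Pi\<^sub>E UNIV (\<lambda>v :: 'h. cball (0::real) (norm v))"
  let ?L = "(\<Inter>a. \<Inter>b. {g :: 'h \<Rightarrow> real. g (a + b) = g a + g b}) \<inter>
    (\<Inter>r. \<Inter>a. {g :: 'h \<Rightarrow> real. g (r *\<^sub>R a) = r * g a})"
  have "compact ?B"
    unfolding compactin_euclidean_iff[symmetric] euclidean_product_topology[symmetric]
    by (simp add: compactin_PiE)
  moreover have "closed ?L"
    by (intro closed_Int closed_INT ballI closed_Collect_eq continuous_intros continuous_on_eval)
  ultimately have "compact (?B \<inter> ?L)"
    by (rule compact_Int_closed)
  moreover have "?B \<inter> ?L = ball_functionals"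
    by (auto simp: ball_functionals_def PiE_iff linear_iff)
  ultimately show ?thesis by simp
qed

text \<open>\<open>cmod_functional g v\<close> is \<open>\<bar>\<langle>v, y\<rangle>\<bar>\<close> when \<open>g = Re \<langle>\<cdot>, y\<rangle>\<close>, because \<open>Re \<langle>\<i>v, y\<rangle> = Im \<langle>v, y\<rangle>\<close>.\<close>

definition cmod_functional :: "('h::complex_hilbert_space \<Rightarrow> real) \<Rightarrow> 'h \<Rightarrow> real"
  where "cmod_functional g v = cmod (Complex (g v) (g (\<i> *\<^sub>C v)))"

lemma cmod_functional_cinner: "cmod_functional (\<lambda>v. Re (cinner v y)) v = cmod (cinner v y)"
  by (simp add: cmod_functional_def cinner_scaleC_left cmod_def)

lemma continuous_on_cmod_functional: "continuous_on A (\<lambda>g. cmod_functional g v)"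
  unfolding cmod_functional_def Complex_eq
  by (intro continuous_intros continuous_on_eval)

lemma ball_functional_cinner:
  fixes y :: "'h::complex_hilbert_space"
  assumes "norm y \<le> 1"
  shows "(\<lambda>v. Re (cinner v y)) \<in> ball_functionals"
proof -
  have "\<bar>Re (cinner v y)\<bar> \<le> norm v" for v
    using abs_Re_le_cmod[of "cinner v y"] cmod_cinner_le[of v y]
      mult_left_mono[OF assms, of "norm v"] by simp
  then show ?thesis
    by (auto simp: ball_functionals_def linear_iff cinner_add_left cinner_scaleR_left)
qed

section \<open>The topology of the projective space\<close>

text \<open>Separation is required on all of \<open>proj_closure\<close> because the point that
  Riesz attaches to a functional in the compact set may have norm below 1.\<close>

lemma separating_finite_neighbourhood:
  fixes x :: "'h::complex_hilbert_space"
  assumes sep: "separates_points proj_closure E proj_fun"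
    and x: "norm x = 1" and c: "c < 1"
  obtains F :: "('h \<times> real) set" where "finite F" "\<And>v d. (v, d) \<in> F \<Longrightarrow> v \<in> E \<and> d > 0"
    "\<And>y. norm y \<le> 1 \<Longrightarrow>
       (\<And>v d. (v, d) \<in> F \<Longrightarrow> \<bar>cmod (cinner v y) - cmod (cinner v x)\<bar> < d) \<Longrightarrow>
       c < cmod (cinner x y)"
proof -
  let ?K = "ball_functionals \<inter> {g. cmod_functional g x \<le> c}"
  define V :: "'h \<times> real \<Rightarrow> ('h \<Rightarrow> real) set"
    where "V = (\<lambda>(v, d). {g. d < \<bar>cmod_functional g v - cmod (cinner v x)\<bar>})"
  have "compact ?K"
    by (intro compact_Int_closed compact_ball_functionals closed_Collect_le
        continuous_on_cmod_functional continuous_on_const)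
  moreover have "open (V i)" if "i \<in> E \<times> {0<..}" for i
    unfolding V_def case_prod_beta
    by (intro open_Collect_less continuous_intros continuous_on_cmod_functional)
  moreover have "?K \<subseteq> (\<Union>i \<in> E \<times> {0<..}. V i)"
  proof
    fix g assume g: "g \<in> ?K"
    then obtain y where y: "norm y \<le> 1" "\<And>v. Re (cinner v y) = g v"
      using riesz_unit_ball[of g] unfolding ball_functionals_def by blast
    then have g_eq: "g = (\<lambda>v. Re (cinner v y))" by auto
    have "cmod (cinner x y) \<le> c"
      using g by (simp add: g_eq cmod_functional_cinner)
    moreover have "cmod (cinner x x) = 1"
      by (simp add: cinner_self x)
    \<comment> \<open>The function of \<open>x\<close> itself tells the classes apart, but
      \<open>x\<close> need not lie in \<open>E\<close>; separation then supplies some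
      \<open>v\<close> in \<open>E\<close>.\<close>
    ultimately have "proj_fun x (phase_orbit y) \<noteq> proj_fun x (phase_orbit x)"
      using c by (simp add: proj_fun_phase_orbit)
    then have "phase_orbit y \<noteq> phase_orbit x" by auto
    moreover have "phase_orbit y \<in> proj_closure" "phase_orbit x \<in> proj_closure"
      using x y(1) by (auto simp: proj_closure_def)
    ultimately obtain v where v: "v \<in> E" "cmod (cinner v y) \<noteq> cmod (cinner v x)"
      using sep unfolding separates_points_def by (metis proj_fun_phase_orbit)
    obtain d where "0 < d" "d < \<bar>cmod (cinner v y) - cmod (cinner v x)\<bar>"
      using dense[of 0 "\<bar>cmod (cinner v y) - cmod (cinner v x)\<bar>"] v(2) by auto
    with v(1) show "g \<in> (\<Union>i \<in> E \<times> {0<..}. V i)"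
      by (auto simp: V_def g_eq cmod_functional_cinner intro!: bexI[of _ "(v, d)"])
  qed
  ultimately obtain F where F: "F \<subseteq> E \<times> {0<..}" "finite F" "?K \<subseteq> (\<Union>i\<in>F. V i)"
    by (rule compactE_image)
  show ?thesis
  proof (rule that[OF F(2)])
    show "v \<in> E \<and> d > 0" if "(v, d) \<in> F" for v d
      using F(1) that by auto
    fix y :: 'h
    assume y: "norm y \<le> 1"
      "\<And>v d. (v, d) \<in> F \<Longrightarrow> \<bar>cmod (cinner v y) - cmod (cinner v x)\<bar> < d"
    \<comment> \<open>A vector within every margin avoids each \<open>V (v, d)\<close>, hence the
      cover of \<open>?K\<close>; lying in \<open>ball_functionals\<close>, it can only violate the
      bound \<open>c\<close>.\<close>
    then have "(\<lambda>v. Re (cinner v y)) \<notin> (\<Union>i\<in>F. V i)"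
      by (force simp: V_def cmod_functional_cinner)
    then have "(\<lambda>v. Re (cinner v y)) \<notin> ?K"
      using F(3) by blast
    then show "c < cmod (cinner x y)"
      using ball_functional_cinner[OF y(1)] by (simp add: cmod_functional_cinner)
  qed
qed

lemma continuous_map_proj_fun:
  "continuous_map proj_topology euclidean (proj_fun (v :: 'h::complex_hilbert_space))"
  unfolding proj_topology_def
proof (rule continuous_compose_quotient_map[OF quotient_map_quotient_topology])
  have "proj_fun v \<circ> phase_orbit = (\<lambda>x. cmod (cinner v x))"
    by (simp add: fun_eq_iff proj_fun_phase_orbit)
  then show "continuous_map (top_of_set (sphere 0 1)) euclidean (proj_fun v \<circ> phase_orbit)"
    by (auto intro!: continuous_intros bounded_linear.continuous_on[OF bounded_linear_cinner])
qed

lemma openin_initial_topology_if_openin_proj_topology: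
  fixes U :: "'h::complex_hilbert_space set set"
  assumes sep: "separates_points proj_closure E proj_fun" and U: "openin proj_topology U"
  shows "openin (initial_topology proj_space E proj_fun) U"
proof (subst openin_subopen, intro ballI)
  let ?I = "initial_topology proj_space E (proj_fun :: 'h \<Rightarrow> _)"
  fix p assume p: "p \<in> U"
  have U': "U \<subseteq> proj_space" "openin (top_of_set (sphere 0 1)) {x \<in> sphere 0 1. phase_orbit x \<in> U}"
    using U by (auto simp: proj_topology_def openin_quotient_topology proj_space_def)
  obtain x where x: "norm x = 1" "p = phase_orbit x"
    using p U'(1) by (auto simp: proj_space_def)
  then have "x \<in> {x \<in> sphere 0 1. phase_orbit x \<in> U}" using p by simp
  then obtain e where e: "e > 0" "\<And>y. norm y = 1 \<Longrightarrow> dist y x < e \<Longrightarrow> phase_orbit y \<in> U"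
    using U'(2) unfolding openin_euclidean_subtopology_iff by auto
  \<comment> \<open>The threshold is chosen so that
    \<open>2 - 2 * cmod (cinner x y) < e\<^sup>2\<close> for unit vectors.\<close>
  obtain F where F: "finite F" "\<And>v d. (v, d) \<in> F \<Longrightarrow> v \<in> E \<and> d > 0"
    "\<And>y. norm y \<le> 1 \<Longrightarrow>
       (\<And>v d. (v, d) \<in> F \<Longrightarrow> \<bar>cmod (cinner v y) - cmod (cinner v x)\<bar> < d) \<Longrightarrow>
       1 - e\<^sup>2 / 2 < cmod (cinner x y)"
  proof (rule separating_finite_neighbourhood[OF sep x(1)])
    show "1 - e\<^sup>2 / 2 < 1" using e(1) by simp
  qed (use that in blast)
  \<comment> \<open>The factor \<open>proj_space\<close> keeps \<open>N\<close> inside the carrier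
    when \<open>F\<close> is empty.\<close>
  define N where "N = (\<Inter>(v, d)\<in>F. {q \<in> proj_space. proj_fun v q \<in> ball (proj_fun v p) d}) \<inter> proj_space"
  have "openin ?I ((\<Inter>(v, d)\<in>F. {q \<in> topspace ?I. proj_fun v q \<in> ball (proj_fun v p) d}) \<inter> topspace ?I)"
  proof (rule openin_INT[OF F(1)], clarify)
    fix v d assume "(v, d) \<in> F"
    then have "continuous_map ?I euclidean (proj_fun v)"
      using F(2) by (intro continuous_map_initial_topology) auto
    then show "openin ?I {q \<in> topspace ?I. proj_fun v q \<in> ball (proj_fun v p) d}"
      by (rule openin_continuous_map_preimage) simp
  qed
  then have "openin ?I N"
    by (simp only: N_def topspace_initial_topology)
  moreover have "p \<in> N"
    using p U'(1) F(2) by (auto simp: N_def)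
  moreover have "N \<subseteq> U"
  proof
    fix q assume q: "q \<in> N"
    then obtain y where y: "norm y = 1" "q = phase_orbit y"
      by (auto simp: N_def proj_space_def)
    have "1 - e\<^sup>2 / 2 < cmod (cinner x y)"
      using q y(1)
      by (intro F(3)) (auto simp: N_def y(2) x(2) proj_fun_phase_orbit dist_real_def abs_minus_commute)
    moreover obtain z where z: "cmod z = 1"
      "(norm (x - z *\<^sub>C y))\<^sup>2 = (norm x)\<^sup>2 + (norm y)\<^sup>2 - 2 * cmod (cinner x y)"
      by (rule ex_phase_norm_diff_power2)
    ultimately have "(norm (x - z *\<^sub>C y))\<^sup>2 < e\<^sup>2"
      using x(1) y(1) by simp
    then have "dist (z *\<^sub>C y) x < e"
      using e(1) by (simp add: dist_norm norm_minus_commute power_less_imp_less_base)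
    \<comment> \<open>The rotated representative is close to \<open>x\<close>, and rotation does not
      change the class.\<close>
    then have "phase_orbit (z *\<^sub>C y) \<in> U"
      using z(1) y(1) by (intro e(2)) (auto simp: norm_scaleC)
    then show "q \<in> U"
      using z(1) y(2) by (simp add: phase_orbit_scaleC)
  qed
  ultimately show "\<exists>N. openin ?I N \<and> p \<in> N \<and> N \<subseteq> U" by blast
qed

text \<open>Testing with \<open>x\<close> and \<open>y\<close> alone suffices: both squared norms
  equal \<open>cmod (cinner x y)\<close>, so a suitable rotation of \<open>y\<close> has distance 0
  from \<open>x\<close>.\<close>

lemma separates_points_UNIV:
  "separates_points proj_closure (UNIV :: 'h::complex_hilbert_space set) proj_fun"
proof -
  have "phase_orbit x = phase_orbit y"
    if eq: "\<And>v. cmod (cinner v x) = cmod (cinner v y)" for x y :: 'h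
  proof -
    obtain z where z: "cmod z = 1"
      "(norm (x - z *\<^sub>C y))\<^sup>2 = (norm x)\<^sup>2 + (norm y)\<^sup>2 - 2 * cmod (cinner x y)"
      by (rule ex_phase_norm_diff_power2)
    have "(norm x)\<^sup>2 = cmod (cinner x y)" "(norm y)\<^sup>2 = cmod (cinner y x)"
      using eq[of x] eq[of y] by (auto simp: cinner_self norm_power)
    then have "x = z *\<^sub>C y"
      using z(2) cmod_cinner_commute[of x y] by simp
    then show ?thesis using z(1) by (simp add: phase_orbit_scaleC)
  qed
  then have "\<exists>v. proj_fun v (phase_orbit x) \<noteq> proj_fun v (phase_orbit y)"
    if "phase_orbit x \<noteq> phase_orbit y" for x y :: 'h
    using that unfolding proj_fun_phase_orbit by blast
  then show ?thesis
    unfolding separates_points_def proj_closure_def by blast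
qed

theorem proposition3p8:
  shows "(\<forall>E :: 'h::complex_hilbert_space set.
            separates_points proj_closure E proj_fun \<longrightarrow>
            proj_topology = initial_topology proj_space E proj_fun)
       \<and> separates_points proj_closure (UNIV :: 'h set) proj_fun
       \<and> proj_topology = initial_topology proj_space (UNIV :: 'h set) proj_fun"
proof -
  have "proj_topology = initial_topology proj_space E proj_fun"
    if "separates_points proj_closure E proj_fun" for E :: "'h set"
    unfolding topology_eq
  proof (intro allI iffI)
    fix U :: "'h set set"
    show "openin proj_topology U \<Longrightarrow> openin (initial_topology proj_space E proj_fun) U"
      by (rule openin_initial_topology_if_openin_proj_topology[OF that])
    show "openin (initial_topology proj_space E proj_fun) U \<Longrightarrow> openin proj_topology U"
      by (rule initial_topology_coarsest[OF topspace_proj_topology continuous_map_proj_fun])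
  qed
  with separates_points_UNIV show ?thesis by blast
qed

end
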